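(* Let $n\ge2$ be an integer, $k>0$, and let $\phi,\eta,p,q\in\mathbb{R}^n$ with $\phi,\ \eta,\ p,\ q-p\in(0,\infty)^n$, and $\zeta\in[0,\infty)^n$. Then $$\frac{\beta_{\zeta,k}^{(p,q)}(\phi;\eta)}{\beta_k(\phi)}\ \le\ \prod_{i=1}^n e^{-\frac{\eta_i^k}{k}}\;{}_1F_{1,k}\!\left(q_i-p_i;q_i;\frac{\eta_i^k}{k}+\frac{\zeta_i^k}{\eta_i^k}\right).$$
   Context: $E_{n-1}=\{(t_1,\dots,t_{n-1})\in\mathbb{R}^{n-1}: t_i\ge 0,\ \sum_{i=1}^{n-1}t_i\le 1\}$; for $t\in E_{n-1}$ put $t_n=1-\sum_{i=1}^{n-1}t_i$, $dt=dt_1\cdots dt_{n-1}$. For $c>0$, $(c)_{0,k}=1$ and $(c)_{m,k}=c(c+k)\cdots(c+(m-1)k)$ for $m\ge1$. For scalars $a,b>0$, ${}_1F_{1,k}(a;b;x)=\sum_{m=0}^\infty \frac{(a)_{m,k}}{(b)_{m,k}}\frac{x^m}{m!}$, $x\in\mathbb{R}$. The generalized beta $k$-function of the second kind is $$\beta_{\zeta,k}^{(p,q)}(\phi;\eta)=\frac1{k^{n-1}}\int_{E_{n-1}}\prod_{i=1}^n \left[t_i^{\frac{\phi_i}{k}-1}\;{}_1F_{1,k}\!\left(p_i;q_i;-\frac{\eta_i^k}{kt_i}-\zeta_i^k\frac{t_i}{\eta_i^k}\right)\right]dt,$$ and $\beta_k(\phi)=\frac1{k^{n-1}}\int_{E_{n-1}}\prod_{i=1}^n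 t_i^{\frac{\phi_i}{k}-1}dt$. *)

theory Defs
  imports "HOL-Analysis.Analysis"
begin

text \<open>
  A point of \<open>\<real>\<^sup>d\<close> is a function \<open>nat \<Rightarrow> real\<close> read on the indices \<open>1, \<dots>, d\<close>. As points of
  a measure space these functions are extensional (undefined off \<open>{1..d}\<close>), and Lebesgue measure
  \<open>dt\<^sub>1 \<cdots> dt\<^sub>d\<close> is the product measure \<open>\<Pi>\<^sub>M i\<in>{1..d}. lborel\<close>.
\<close>

definition simplex_E :: "nat \<Rightarrow> (nat \<Rightarrow> real) set" where
  "simplex_E d = {t \<in> {1..d} \<rightarrow>\<^sub>E UNIV. (\<forall>i\<in>{1..d}. 0 \<le> t i) \<and> (\<Sum>i=1..d. t i) \<le> 1}"

definition complete_coords :: "nat \<Rightarrow> (nat \<Rightarrow> real) \<Rightarrow> nat \<Rightarrow> real" where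
  "complete_coords n t = t(n := 1 - (\<Sum>i=1..n-1. t i))"

definition kpochhammer :: "real \<Rightarrow> real \<Rightarrow> nat \<Rightarrow> real" where
  "kpochhammer k c m = (\<Prod>j<m. c + real j * k)"

definition hyp1F1k :: "real \<Rightarrow> real \<Rightarrow> real \<Rightarrow> real \<Rightarrow> real" where
  "hyp1F1k k a b x = (\<Sum>m. kpochhammer k a m / kpochhammer k b m * (x ^ m / fact m))"

text \<open>
  The integrands below may be singular or undefined where some \<open>t\<^sub>i = 0\<close>; there they take the
  values given by \<open>0 powr a = 0\<close> and \<open>x / 0 = 0\<close>, on a null set.
\<close>

definition beta_k :: "nat \<Rightarrow> real \<Rightarrow> (nat \<Rightarrow> real) \<Rightarrow> real" where
  "beta_k n k \<phi> = 1 / k ^ (n - 1) *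
     (LINT t : simplex_E (n - 1) | (\<Pi>\<^sub>M i\<in>{1..n-1}. lborel).
        (\<Prod>i=1..n. complete_coords n t i powr (\<phi> i / k - 1)))"

definition gen_beta_k ::
  "nat \<Rightarrow> real \<Rightarrow> (nat \<Rightarrow> real) \<Rightarrow> (nat \<Rightarrow> real) \<Rightarrow> (nat \<Rightarrow> real) \<Rightarrow> (nat \<Rightarrow> real) \<Rightarrow> (nat \<Rightarrow> real) \<Rightarrow> real" where
  "gen_beta_k n k \<zeta> p q \<phi> \<eta> = 1 / k ^ (n - 1) *
     (LINT t : simplex_E (n - 1) | (\<Pi>\<^sub>M i\<in>{1..n-1}. lborel).
        (\<Prod>i=1..n.
           complete_coords n t i powr (\<phi> i / k - 1) *
           hyp1F1k k (p i) (q i)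
             (- (\<eta> i powr k / (k * complete_coords n t i))
              - \<zeta> i powr k * (complete_coords n t i / \<eta> i powr k))))"

end

theory Submission
  imports Defs
begin

text \<open>
  By Kummer's transformation each factor \<open>\<^sub>1F\<^sub>1\<^sub>,\<^sub>k(p; q; -z)\<close> equals
  \<open>e\<^sup>-\<^sup>z \<^sub>1F\<^sub>1\<^sub>,\<^sub>k(q - p; q; z)\<close>. This is decreasing in \<open>z \<ge> 0\<close>, because the coefficients
  \<open>(q - p)\<^sub>m\<^sub>,\<^sub>k / (q)\<^sub>m\<^sub>,\<^sub>k\<close> decrease in \<open>m\<close>. With \<open>A = \<eta>\<^sup>k / k\<close>, \<open>C = \<zeta>\<^sup>k / \<eta>\<^sup>k\<close> and \<open>0 < t \<le> 1\<close>,
  the argument \<open>z = A / t + C t\<close> is at least \<open>A\<close>, so the factor is at most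
  \<open>e\<^sup>-\<^sup>A \<^sub>1F\<^sub>1\<^sub>,\<^sub>k(q - p; q; A)\<close>, hence at most \<open>e\<^sup>-\<^sup>A \<^sub>1F\<^sub>1\<^sub>,\<^sub>k(q - p; q; A + C)\<close>. The integrands
  are thus comparable pointwise, with a constant that does not depend on \<open>t\<close>.
\<close>

section \<open>Pochhammer \<open>k\<close>-symbols and their ratios\<close>

lemma kpochhammer_0 [simp]: "kpochhammer k c 0 = 1"
  by (simp add: kpochhammer_def)

lemma kpochhammer_Suc: "kpochhammer k c (Suc m) = kpochhammer k c m * (c + real m * k)"
  by (simp add: kpochhammer_def)

lemma kpochhammer_rec: "kpochhammer k c (Suc m) = c * kpochhammer k (c + k) m"
  unfolding kpochhammer_def prod.lessThan_Suc_shift by (simp add: algebra_simps)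

lemma kpochhammer_pos:
  assumes "k > 0" "c > 0"
  shows "kpochhammer k c m > 0"
  unfolding kpochhammer_def using assms by (intro prod_pos) (simp add: add_pos_nonneg)

text \<open>Passing from \<open>m\<close> to \<open>m + 1\<close> multiplies the ratio by
  \<open>(a + m k) / (b + m k)\<close>, which is at most 1 because \<open>a \<le> b\<close>.\<close>

lemma kpochhammer_ratio_Suc_le:
  assumes "k > 0" "a > 0" "a \<le> b"
  shows "kpochhammer k a (Suc m) / kpochhammer k b (Suc m) \<le> kpochhammer k a m / kpochhammer k b m"
proof -
  have "b + real m * k > 0"
    using assms by (simp add: add_pos_nonneg)
  then have "(a + real m * k) / (b + real m * k) \<le> 1"
    using assms by simp
  moreover have "kpochhammer k a m / kpochhammer k b m \<ge> 0"
    using assms by (simp add: kpochhammer_pos less_imp_le)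
  ultimately have "kpochhammer k a m / kpochhammer k b m * ((a + real m * k) / (b + real m * k))
      \<le> kpochhammer k a m / kpochhammer k b m"
    by (rule mult_left_le)
  then show ?thesis
    by (simp add: kpochhammer_Suc)
qed

lemma kpochhammer_ratio_le_1:
  assumes "k > 0" "a > 0" "a \<le> b"
  shows "kpochhammer k a m / kpochhammer k b m \<le> 1"
  by (induction m) (auto intro: order_trans[OF kpochhammer_ratio_Suc_le[OF assms]])

text \<open>
  The Chu--Vandermonde identity, read as an \<open>m\<close>-th finite difference: Pascal's rule reduces \<open>m + 1\<close>
  at \<open>(a, b)\<close> to \<open>m\<close> at \<open>(a, b)\<close> and at \<open>(a + k, b + k)\<close>.
\<close>

lemma alternating_sum_kpochhammer_ratio:
  assumes "k > 0" "b > 0"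
  shows "(\<Sum>j\<le>m. real (m choose j) * (-1) ^ j * (kpochhammer k a j / kpochhammer k b j))
    = kpochhammer k (b - a) m / kpochhammer k b m"
  using assms(2)
proof (induction m arbitrary: a b)
  case 0
  then show ?case by simp
next
  case (Suc m)
  let ?c = "\<lambda>a b j. kpochhammer k a j / kpochhammer k b j"
  let ?t = "\<lambda>m j. real (m choose j) * (-1) ^ j * ?c a b j"
  have shift: "?c a b (Suc j) = a / b * ?c (a + k) (b + k) j" for j
    by (simp add: kpochhammer_rec)
  have "(\<Sum>j\<le>Suc m. ?t (Suc m) j) = 1 + (\<Sum>j\<le>m. ?t (Suc m) (Suc j))"
    by (subst sum.atMost_Suc_shift) simp
  \<comment> \<open>Pascal's rule splits each coefficient \<open>Suc m choose Suc j\<close>.\<close>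
  also have "(\<Sum>j\<le>m. ?t (Suc m) (Suc j))
      = (\<Sum>j\<le>m. ?t m (Suc j)) + (\<Sum>j\<le>m. real (m choose j) * (-1) ^ Suc j * ?c a b (Suc j))"
    unfolding sum.distrib[symmetric]
    by (intro sum.cong) (auto simp: algebra_simps add_divide_distrib diff_divide_distrib)
  also have "(\<Sum>j\<le>m. real (m choose j) * (-1) ^ Suc j * ?c a b (Suc j))
      = - (a / b) * (\<Sum>j\<le>m. real (m choose j) * (-1) ^ j * ?c (a + k) (b + k) j)"
    unfolding shift sum_distrib_left by (intro sum.cong) auto
  \<comment> \<open>The leading 1 is the \<open>j = 0\<close> term, so it completes the shifted sum
    to one up to \<open>Suc m\<close>. The top term of that sum then drops out, since
    \<open>m choose Suc m\<close> is 0.\<close>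
  also have "1 + ((\<Sum>j\<le>m. ?t m (Suc j))
      + - (a / b) * (\<Sum>j\<le>m. real (m choose j) * (-1) ^ j * ?c (a + k) (b + k) j))
      = (\<Sum>j\<le>Suc m. ?t m j)
      - a / b * (\<Sum>j\<le>m. real (m choose j) * (-1) ^ j * ?c (a + k) (b + k) j)"
    by (simp add: sum.atMost_Suc_shift del: sum.atMost_Suc)
  also have "(\<Sum>j\<le>Suc m. ?t m j) = (\<Sum>j\<le>m. ?t m j)"
    by simp
  also have "\<dots> = ?c (b - a) b m"
    using Suc.prems by (rule Suc.IH)
  \<comment> \<open>The difference \<open>b - a\<close> is unchanged when both parameters move by
    \<open>k\<close>, so both instances of the induction hypothesis share a numerator.\<close>
  also have "(\<Sum>j\<le>m. real (m choose j) * (-1) ^ j * ?c (a + k) (b + k) j)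
      = kpochhammer k (b - a) m / kpochhammer k (b + k) m"
    using Suc.IH[of "b + k" "a + k"] Suc.prems assms(1) by simp
  also have "?c (b - a) b m - a / b * (kpochhammer k (b - a) m / kpochhammer k (b + k) m)
      = ?c (b - a) b m - a * kpochhammer k (b - a) m / kpochhammer k b (Suc m)"
    by (simp add: kpochhammer_rec)
  \<comment> \<open>Over the common denominator the claim is
    \<open>(b + m k) - a = (b - a) + m k\<close>.\<close>
  also have "\<dots> = ?c (b - a) b (Suc m)"
  proof -
    have "b + real m * k > 0" "kpochhammer k b m > 0"
      using Suc.prems assms(1) by (simp_all add: add_pos_nonneg kpochhammer_pos)
    then have "?c (b - a) b m = kpochhammer k (b - a) m * (b + real m * k) / kpochhammer k b (Suc m)"
      by (simp add: kpochhammer_Suc)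
    then show ?thesis
      by (simp add: kpochhammer_Suc[of k "b - a"] algebra_simps flip: diff_divide_distrib)
  qed
  finally show ?case .
qed

section \<open>The series \<open>hyp1F1k\<close>: convergence, Kummer's transformation,
  monotonicity\<close>

lemma summable_norm_hyp1F1k:
  assumes "k > 0" "a > 0" "a \<le> b"
  shows "summable (\<lambda>m. norm (kpochhammer k a m / kpochhammer k b m * (x ^ m / fact m)))"
proof (rule summable_comparison_test')
  show "summable (\<lambda>m. norm (x ^ m / fact m))"
    using summable_norm_exp[of x] by (simp add: field_simps)
  fix m :: nat
  have "kpochhammer k a m / kpochhammer k b m \<ge> 0"
    using assms by (simp add: kpochhammer_pos less_imp_le)
  then have "norm (kpochhammer k a m / kpochhammer k b m * (x ^ m / fact m))
      = kpochhammer k a m / kpochhammer k b m * norm (x ^ m / fact m)"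
    by (metis abs_mult abs_of_nonneg real_norm_def)
  also have "\<dots> \<le> norm (x ^ m / fact m)"
    using \<open>kpochhammer k a m / kpochhammer k b m \<ge> 0\<close> kpochhammer_ratio_le_1[OF assms]
    by (intro mult_left_le_one_le) auto
  finally show "norm (norm (kpochhammer k a m / kpochhammer k b m * (x ^ m / fact m)))
      \<le> norm (x ^ m / fact m)"
    by simp
qed

lemmas summable_hyp1F1k = summable_norm_cancel[OF summable_norm_hyp1F1k]

lemma hyp1F1k_nonneg:
  assumes "k > 0" "a > 0" "a \<le> b" "x \<ge> 0"
  shows "hyp1F1k k a b x \<ge> 0"
  unfolding hyp1F1k_def using assms
  by (intro suminf_nonneg summable_hyp1F1k) (auto simp: kpochhammer_pos less_imp_le)

lemma hyp1F1k_mono: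
  assumes "k > 0" "a > 0" "a \<le> b" "0 \<le> x" "x \<le> y"
  shows "hyp1F1k k a b x \<le> hyp1F1k k a b y"
  unfolding hyp1F1k_def using assms
  by (intro suminf_le summable_hyp1F1k mult_left_mono divide_right_mono power_mono)
    (auto simp: kpochhammer_pos less_imp_le)

text \<open>The right-hand side is a Cauchy product of two absolutely convergent series; its
  coefficients are the alternating sums evaluated by Chu--Vandermonde.\<close>

lemma hyp1F1k_kummer:
  assumes "k > 0" "a > 0" "a < b"
  shows "hyp1F1k k (b - a) b (- z) = exp (- z) * hyp1F1k k a b z"
proof -
  let ?c = "\<lambda>j. kpochhammer k a j / kpochhammer k b j"
  have "(\<lambda>m. \<Sum>j\<le>m. ?c j * (z ^ j / fact j) * ((- z) ^ (m - j) /\<^sub>R fact (m - j)))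
      sums ((\<Sum>j. ?c j * (z ^ j / fact j)) * (\<Sum>j. (- z) ^ j /\<^sub>R fact j))"
    using assms by (intro Cauchy_product_sums summable_norm_hyp1F1k summable_norm_exp) auto
  moreover have "(\<Sum>j\<le>m. ?c j * (z ^ j / fact j) * ((- z) ^ (m - j) /\<^sub>R fact (m - j)))
      = kpochhammer k (b - a) m / kpochhammer k b m * ((- z) ^ m / fact m)" for m
  proof -
    have "?c j * (z ^ j / fact j) * ((- z) ^ (m - j) /\<^sub>R fact (m - j))
        = (- z) ^ m / fact m * (real (m choose j) * (-1) ^ j * ?c j)" if "j \<le> m" for j
    proof -
      have "(- z) ^ m = (- z) ^ j * (- z) ^ (m - j)"
        using that by (simp flip: power_add)
      moreover have "(- z) ^ j * (-1) ^ j = z ^ j"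
        by (simp flip: power_mult_distrib)
      ultimately have "z ^ j * (- z) ^ (m - j) = (- z) ^ m * (-1) ^ j"
        by (simp add: mult_ac)
      then show ?thesis
        using that by (simp add: binomial_fact field_simps)
    qed
    then have "(\<Sum>j\<le>m. ?c j * (z ^ j / fact j) * ((- z) ^ (m - j) /\<^sub>R fact (m - j)))
        = (- z) ^ m / fact m * (\<Sum>j\<le>m. real (m choose j) * (-1) ^ j * ?c j)"
      unfolding sum_distrib_left by (intro sum.cong) auto
    also have "(\<Sum>j\<le>m. real (m choose j) * (-1) ^ j * ?c j)
        = kpochhammer k (b - a) m / kpochhammer k b m"
      using assms by (intro alternating_sum_kpochhammer_ratio) auto
    finally show ?thesis
      by (simp add: mult.commute)
  qed
  ultimately show ?thesis
    by (simp add: hyp1F1k_def exp_def sums_iff mult.commute)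
qed

text \<open>Termwise differentiation. The result is kept as a series with shifted coefficients so
  that it can be compared with \<open>hyp1F1k\<close> term by term.\<close>

lemma hyp1F1k_has_derivative:
  assumes "k > 0" "a > 0" "a \<le> b"
  shows "(hyp1F1k k a b has_real_derivative
    (\<Sum>m. kpochhammer k a (Suc m) / kpochhammer k b (Suc m) * (x ^ m / fact m))) (at x)"
proof -
  let ?d = "\<lambda>m. kpochhammer k a m / kpochhammer k b m / fact m"
  have "((\<lambda>x. \<Sum>m. ?d m * x ^ m) has_real_derivative (\<Sum>m. diffs ?d m * x ^ m)) (at x)"
    using summable_hyp1F1k[OF assms] by (intro termdiffs_strong_converges_everywhere) simp
  moreover have "diffs ?d m * x ^ m
      = kpochhammer k a (Suc m) / kpochhammer k b (Suc m) * (x ^ m / fact m)" for m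
    unfolding diffs_def fact_Suc by (simp add: field_simps del: of_nat_Suc)
  ultimately show ?thesis
    unfolding hyp1F1k_def[abs_def] by simp
qed

text \<open>The derivative of \<open>exp (- z) * F z\<close> is
  \<open>exp (- z) * (F' z - F z)\<close>, and \<open>F' \<le> F\<close> holds termwise for
  \<open>z \<ge> 0\<close> because the coefficient ratios decrease.\<close>

lemma exp_times_hyp1F1k_antimono:
  assumes "k > 0" "a > 0" "a \<le> b" "0 \<le> x" "x \<le> y"
  shows "exp (- y) * hyp1F1k k a b y \<le> exp (- x) * hyp1F1k k a b x"
proof (rule DERIV_nonpos_imp_nonincreasing[OF assms(5)])
  fix z assume "x \<le> z" "z \<le> y"
  define D where "D = (\<Sum>m. kpochhammer k a (Suc m) / kpochhammer k b (Suc m) * (z ^ m / fact m))"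
  have term_le: "kpochhammer k a (Suc m) / kpochhammer k b (Suc m) * (z ^ m / fact m)
      \<le> kpochhammer k a m / kpochhammer k b m * (z ^ m / fact m)" for m
    using \<open>x \<le> z\<close> assms by (intro mult_right_mono kpochhammer_ratio_Suc_le) auto
  have sm: "summable (\<lambda>m. kpochhammer k a m / kpochhammer k b m * (z ^ m / fact m))"
    using assms by (intro summable_hyp1F1k)
  have "D \<le> hyp1F1k k a b z"
    unfolding D_def hyp1F1k_def
  proof (intro suminf_le term_le sm summable_comparison_test'[OF sm])
    fix m
    have "0 \<le> kpochhammer k a (Suc m) / kpochhammer k b (Suc m) * (z ^ m / fact m)"
      using assms \<open>x \<le> z\<close>
      by (intro mult_nonneg_nonneg) (auto simp: kpochhammer_pos less_imp_le)
    then show "norm (kpochhammer k a (Suc m) / kpochhammer k b (Suc m) * (z ^ m / fact m))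
        \<le> kpochhammer k a m / kpochhammer k b m * (z ^ m / fact m)"
      using term_le by (simp only: real_norm_def abs_of_nonneg)
  qed
  then have "exp (- z) * (D - hyp1F1k k a b z) \<le> 0"
    by (simp add: mult_nonneg_nonpos)
  moreover have "((\<lambda>z. exp (- z) * hyp1F1k k a b z) has_real_derivative
      exp (- z) * (D - hyp1F1k k a b z)) (at z)"
    unfolding D_def
    by (rule derivative_eq_intros hyp1F1k_has_derivative assms refl | simp add: algebra_simps)+
  ultimately show "\<exists>d. ((\<lambda>z. exp (- z) * hyp1F1k k a b z) has_real_derivative d) (at z) \<and> d \<le> 0"
    by blast
qed

lemma hyp1F1k_kummer_bounds:
  assumes "k > 0" "p > 0" "p < q" "A \<ge> 0" "C \<ge> 0" "0 < t" "t \<le> 1"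
  shows "0 \<le> hyp1F1k k p q (- (A / t) - C * t)"
    and "hyp1F1k k p q (- (A / t) - C * t) \<le> exp (- A) * hyp1F1k k (q - p) q (A + C)"
proof -
  have "A \<le> A / t"
    using assms by (simp add: field_simps mult_left_le)
  then have le: "A \<le> A / t + C * t"
    using assms by (simp add: add_increasing2)
  \<comment> \<open>Kummer's transformation is used with first parameter \<open>q - p\<close>, so
    that \<open>q - (q - p)\<close> gives back \<open>p\<close>.\<close>
  have eq: "hyp1F1k k p q (- (A / t) - C * t)
      = exp (- (A / t + C * t)) * hyp1F1k k (q - p) q (A / t + C * t)"
    using hyp1F1k_kummer[of k "q - p" q "A / t + C * t"] assms by simp
  show "0 \<le> hyp1F1k k p q (- (A / t) - C * t)"
    unfolding eq using assms le by (intro mult_nonneg_nonneg hyp1F1k_nonneg) auto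
  have "hyp1F1k k p q (- (A / t) - C * t) \<le> exp (- A) * hyp1F1k k (q - p) q A"
    unfolding eq using assms le by (intro exp_times_hyp1F1k_antimono) auto
  also have "\<dots> \<le> exp (- A) * hyp1F1k k (q - p) q (A + C)"
    using assms by (intro mult_left_mono hyp1F1k_mono) auto
  finally show "hyp1F1k k p q (- (A / t) - C * t) \<le> exp (- A) * hyp1F1k k (q - p) q (A + C)" .
qed

section \<open>Simplex coordinates and comparison of the integrals\<close>

lemma complete_coords_bounds:
  assumes "t \<in> simplex_E (n - 1)" "i \<in> {1..n}"
  shows "0 \<le> complete_coords n t i" "complete_coords n t i \<le> 1"
proof -
  have nonneg: "0 \<le> t j" if "j \<in> {1..n-1}" for j
    using assms(1) that by (auto simp: simplex_E_def)
  have le1: "(\<Sum>j=1..n-1. t j) \<le> 1"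
    using assms(1) by (auto simp: simplex_E_def)
  have "0 \<le> complete_coords n t i \<and> complete_coords n t i \<le> 1"
  proof (cases "i = n")
    case True
    then show ?thesis
      using le1 sum_nonneg[of "{1..n-1}" t] nonneg by (simp add: complete_coords_def)
  next
    case False
    then have i: "i \<in> {1..n-1}"
      using assms(2) by auto
    have "t i \<le> (\<Sum>j=1..n-1. t j)"
      using i nonneg by (intro member_le_sum) auto
    with False i nonneg le1 show ?thesis
      by (auto simp: complete_coords_def)
  qed
  then show "0 \<le> complete_coords n t i" "complete_coords n t i \<le> 1"
    by auto
qed

theorem theorem2p7:
  fixes n :: nat and k :: real and \<phi> \<eta> p q \<zeta> :: "nat \<Rightarrow> real"
  assumes "n \<ge> 2"
    and "k > 0"
    and "\<forall>i\<in>{1..n}. \<phi> i > 0"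
    and "\<forall>i\<in>{1..n}. \<eta> i > 0"
    and "\<forall>i\<in>{1..n}. p i > 0"
    and "\<forall>i\<in>{1..n}. q i - p i > 0"
    and "\<forall>i\<in>{1..n}. \<zeta> i \<ge> 0"
  shows "gen_beta_k n k \<zeta> p q \<phi> \<eta> / beta_k n k \<phi> \<le>
    (\<Prod>i=1..n. exp (- (\<eta> i powr k / k)) *
       hyp1F1k k (q i - p i) (q i) (\<eta> i powr k / k + \<zeta> i powr k / \<eta> i powr k))"
proof -
  define M where "M = (\<Pi>\<^sub>M i\<in>{1..n-1}. (lborel :: real measure))"
  define S where "S = simplex_E (n - 1)"
  define B where "B i = exp (- (\<eta> i powr k / k)) *
       hyp1F1k k (q i - p i) (q i) (\<eta> i powr k / k + \<zeta> i powr k / \<eta> i powr k)" for i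
  define w where "w t = (\<Prod>i=1..n. complete_coords n t i powr (\<phi> i / k - 1))" for t
  define h where "h t i = hyp1F1k k (p i) (q i)
             (- (\<eta> i powr k / (k * complete_coords n t i))
              - \<zeta> i powr k * (complete_coords n t i / \<eta> i powr k))" for t i
  define g where "g t = (\<Prod>i=1..n. complete_coords n t i powr (\<phi> i / k - 1) * h t i)" for t
  define I where "I = (LINT t : S | M. w t)"
  have B_nonneg: "0 \<le> B i" if "i \<in> {1..n}" for i
  proof -
    have "0 < \<eta> i" "0 < p i" "0 < q i - p i" "0 \<le> \<zeta> i"
      using assms that by auto
    then show ?thesis
      unfolding B_def using \<open>k > 0\<close> by (intro mult_nonneg_nonneg hyp1F1k_nonneg) auto
  qed
  have C_nonneg: "0 \<le> prod B {1..n}"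
    using B_nonneg by (intro prod_nonneg) auto
  have w_nonneg: "0 \<le> w t" for t
    unfolding w_def by (intro prod_nonneg) auto
  have g_le: "g t \<le> prod B {1..n} * w t" if "t \<in> S" for t
  proof -
    \<comment> \<open>The lower bound 0 is carried along because factorwise comparison of products
      requires it.\<close>
    have "0 \<le> complete_coords n t i powr (\<phi> i / k - 1) * h t i \<and>
        complete_coords n t i powr (\<phi> i / k - 1) * h t i
        \<le> B i * complete_coords n t i powr (\<phi> i / k - 1)" if "i \<in> {1..n}" for i
    \<comment> \<open>On the boundary, \<open>0 powr a = 0\<close> makes both sides vanish; the
      Kummer bounds cover positive coordinates only.\<close>
    proof (cases "complete_coords n t i = 0")
      case True
      then show ?thesis by simp
    next
      case False
      then have t: "0 < complete_coords n t i" "complete_coords n t i \<le> 1"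
        using complete_coords_bounds[OF \<open>t \<in> S\<close>[unfolded S_def] that] by auto
      have "0 \<le> h t i" "h t i \<le> B i"
        using hyp1F1k_kummer_bounds[of k "p i" "q i" "\<eta> i powr k / k" "\<zeta> i powr k / \<eta> i powr k",
            OF _ _ _ _ _ t] assms that
        by (simp_all add: h_def B_def)
      then show ?thesis
        by (simp add: mult.commute[of "B i"] mult_left_mono)
    qed
    then show ?thesis
      unfolding g_def w_def prod.distrib[symmetric] by (intro prod_mono) auto
  qed
  have I_nonneg: "0 \<le> I"
    unfolding I_def set_lebesgue_integral_def using w_nonneg
    by (intro Bochner_Integration.integral_nonneg) auto
  have "(LINT t : S | M. g t) / I \<le> prod B {1..n}"
  \<comment> \<open>If \<open>I = 0\<close>, the quotient is 0 by the convention
    \<open>x / 0 = 0\<close>.\<close>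
  proof (cases "I = 0")
    case True
    then show ?thesis using C_nonneg by simp
  next
    case False
    \<comment> \<open>A non-integrable function has integral 0, so \<open>I \<noteq> 0\<close>
      already yields integrability of the weight.\<close>
    then have "integrable M (\<lambda>t. indicator S t *\<^sub>R w t)"
      unfolding I_def set_lebesgue_integral_def using not_integrable_integral_eq by blast
    then have "(LINT t : S | M. g t)
        \<le> (LINT t | M. prod B {1..n} * (indicator S t *\<^sub>R w t))"
      unfolding set_lebesgue_integral_def using C_nonneg w_nonneg g_le
      \<comment> \<open>Only the nonnegative majorant has to be integrable: if \<open>g\<close> is
        not integrable on \<open>S\<close>, its integral is 0 and the bound still holds.\<close>
      by (intro integral_mono') (auto simp: indicator_def)
    also have "\<dots> = prod B {1..n} * I"
      by (simp add: I_def set_lebesgue_integral_def)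
    finally show ?thesis
      using False I_nonneg by (simp add: divide_le_eq)
  qed
  \<comment> \<open>The common factor \<open>1 / k ^ (n - 1)\<close> cancels.\<close>
  moreover have "gen_beta_k n k \<zeta> p q \<phi> \<eta> / beta_k n k \<phi> = (LINT t : S | M. g t) / I"
    using \<open>k > 0\<close> by (simp add: gen_beta_k_def beta_k_def M_def S_def I_def g_def w_def h_def)
  ultimately show ?thesis
    by (simp add: B_def)
qed

end
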